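(* Let $q$ be a (measurable) $Q$-function. Consider the following conditions. (A1) There exist Borel subsets $B_n$, $n=1,2,\ldots$, of $\mathbf{X}$ such that $\sup_{x\in B_n}\bar q(x)<n$ for all $n=1,2,\ldots$ and $B_n\uparrow\mathbf{X}$ as $n\to\infty$. (A2) $\bar q(x)<\infty$ for each $x\in\mathbf{X}$. (A3) $\sup_{t\in[T_0,s[}q(x,t)<\infty$ for each $s\in\,]T_0,T_1[$ and $x\in\mathbf{X}$. (A4) $\int_{T_0}^s q(x,t)\,dt<\infty$ for each $s\in\,]T_0,T_1[$ and $x\in\mathbf{X}$. Then: (a) (A1) and (A2) are equivalent; (b) (A2) implies (A3); (c) (A3) implies (A4).
   Context: Intervals: $]a,b[$ and $[a,b[$ denote open and half-open intervals. $(\mathbf{X},\mathfrak{B}(\mathbf{X}))$ is a standard Borel space; $0\le T_0<T_1\le\infty$; measurability means Borel measurability. $Q$-function: a function $q(x,t,B)$, $x\in\mathbf{X}$, $t\in[T_0,T_1[$, $B\in\mathfrak{B}(\mathbf{X})$, such that (a) for all $x,t$, $q(x,t,\cdot)$ is a (finite) signed measure with $q(x,t,\mathbf{X})\le 0$ and $0\le q(x,t,B\setminus\{x\})<\infty$ for all $B$; (b) for each $B$, $q(x,t,B)$ is measurable in $(x,t)$. Standing assumption: $q$ is conservative, i.e. $q(x,t,\mathbf{X})=0$ for all $x,t$. Put $q(x,t):=-q(x,t,\{x\})\ge 0$ and $\bar q(x):=\sup_{t\in[T_0,T_1[}q(x,t)\in[0,\infty]$. Suprema of subsets of $[0,\infty]$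 are taken in $[0,\infty]$, so the supremum over the empty set is $0$. $B_n\uparrow\mathbf{X}$ means $B_n\subseteq B_{n+1}$ for all $n$ and $\bigcup_n B_n=\mathbf{X}$. *)

theory Defs
  imports "HOL-Analysis.Analysis"
begin

definition standard_borel :: "'a measure \<Rightarrow> bool" where
  "standard_borel M \<longleftrightarrow>
    (\<exists>X. completely_metrizable_space X \<and> second_countable X \<and> topspace X = space M \<and>
         sets M = sigma_sets (topspace X) {U. openin X U})"

(* The values are real numbers, so finiteness is part of the type; only values on sets M matter. *)
definition signed_measure :: "'a measure \<Rightarrow> ('a set \<Rightarrow> real) \<Rightarrow> bool" where
  "signed_measure M \<mu> \<longleftrightarrow>
    \<mu> {} = 0 \<and>
    (\<forall>A :: nat \<Rightarrow> 'a set. range A \<subseteq> sets M \<longrightarrow> disjoint_family A \<longrightarrow>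
       (\<lambda>i. \<mu> (A i)) sums \<mu> (\<Union>i. A i))"

(* The half-open interval [T0, T1[, where T1 may be infinite. *)
definition time_interval :: "real \<Rightarrow> ereal \<Rightarrow> real set" where
  "time_interval T0 T1 = {t. T0 \<le> t \<and> ereal t < T1}"

definition Q_function ::
  "'a measure \<Rightarrow> real \<Rightarrow> ereal \<Rightarrow> ('a \<Rightarrow> real \<Rightarrow> 'a set \<Rightarrow> real) \<Rightarrow> bool" where
  "Q_function M T0 T1 q \<longleftrightarrow>
    (\<forall>x\<in>space M. \<forall>t\<in>time_interval T0 T1.
       signed_measure M (q x t) \<and> q x t (space M) \<le> 0 \<and>
       (\<forall>B\<in>sets M. 0 \<le> q x t (B - {x}))) \<and>
    (\<forall>B\<in>sets M. (\<lambda>(x, t). q x t B)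
       \<in> borel_measurable (M \<Otimes>\<^sub>M restrict_space borel (time_interval T0 T1)))"

definition conservative ::
  "'a measure \<Rightarrow> real \<Rightarrow> ereal \<Rightarrow> ('a \<Rightarrow> real \<Rightarrow> 'a set \<Rightarrow> real) \<Rightarrow> bool" where
  "conservative M T0 T1 q \<longleftrightarrow>
    (\<forall>x\<in>space M. \<forall>t\<in>time_interval T0 T1. q x t (space M) = 0)"

definition exit_rate :: "('a \<Rightarrow> real \<Rightarrow> 'a set \<Rightarrow> real) \<Rightarrow> 'a \<Rightarrow> real \<Rightarrow> real" where
  "exit_rate q x t = - q x t {x}"

(* Suprema are taken in ennreal = [0, \<infinity>], where the empty supremum is 0.  The coercion ennreal
   truncates negative reals to 0, but exit rates of a Q-function are nonnegative on
   space M and [T0, T1[. *)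
definition sup_rate ::
  "real \<Rightarrow> ereal \<Rightarrow> ('a \<Rightarrow> real \<Rightarrow> 'a set \<Rightarrow> real) \<Rightarrow> 'a \<Rightarrow> ennreal" where
  "sup_rate T0 T1 q x = (SUP t\<in>time_interval T0 T1. ennreal (exit_rate q x t))"

definition A1 ::
  "'a measure \<Rightarrow> real \<Rightarrow> ereal \<Rightarrow> ('a \<Rightarrow> real \<Rightarrow> 'a set \<Rightarrow> real) \<Rightarrow> bool" where
  "A1 M T0 T1 q \<longleftrightarrow>
    (\<exists>B :: nat \<Rightarrow> 'a set.
       (\<forall>n\<ge>1. B n \<in> sets M \<and> (SUP x\<in>B n. sup_rate T0 T1 q x) < of_nat n \<and> B n \<subseteq> B (Suc n)) \<and>
       (\<Union>n\<in>{1..}. B n) = space M)"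

definition A2 ::
  "'a measure \<Rightarrow> real \<Rightarrow> ereal \<Rightarrow> ('a \<Rightarrow> real \<Rightarrow> 'a set \<Rightarrow> real) \<Rightarrow> bool" where
  "A2 M T0 T1 q \<longleftrightarrow> (\<forall>x\<in>space M. sup_rate T0 T1 q x < \<infinity>)"

definition A3 ::
  "'a measure \<Rightarrow> real \<Rightarrow> ereal \<Rightarrow> ('a \<Rightarrow> real \<Rightarrow> 'a set \<Rightarrow> real) \<Rightarrow> bool" where
  "A3 M T0 T1 q \<longleftrightarrow>
    (\<forall>s. T0 < s \<longrightarrow> ereal s < T1 \<longrightarrow>
       (\<forall>x\<in>space M. (SUP t\<in>{T0..<s}. ennreal (exit_rate q x t)) < \<infinity>))"

definition A4 ::
  "'a measure \<Rightarrow> real \<Rightarrow> ereal \<Rightarrow> ('a \<Rightarrow> real \<Rightarrow> 'a set \<Rightarrow> real) \<Rightarrow> bool" where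
  "A4 M T0 T1 q \<longleftrightarrow>
    (\<forall>s. T0 < s \<longrightarrow> ereal s < T1 \<longrightarrow>
       (\<forall>x\<in>space M. (\<integral>\<^sup>+t\<in>{T0..s}. ennreal (exit_rate q x t) \<partial>lborel) < \<infinity>))"

end

theory Submission
  imports Defs
begin

text \<open>
  The only delicate implication is from (A2) to (A1): \<open>sup_rate\<close> is a supremum over uncountably many
  times, so its superlevel sets \<open>A\<^sub>n = {x. \<exists>t. q(x,t) > n}\<close> are projections of Borel sets and in general
  only analytic, not Borel.  Under (A2) they have empty intersection, and Novikov's separation theorem
  yields Borel sets \<open>C\<^sub>n \<supseteq> A\<^sub>n\<close> that still have empty intersection; the sets
  \<open>B\<^sub>n = X - (C\<^sub>0 \<inter> \<dots> \<inter> C\<^sub>n\<^sub>-\<^sub>1)\<close> then witness (A1).  Joint measurability of \<open>q(x,t)\<close> is obtained by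
  approximating \<open>{x}\<close> by the cells containing \<open>x\<close> of a refining sequence of finite Borel partitions.

  Novikov's theorem is proved by contradiction.  If a sequence \<open>f(F\<^sub>n)\<close> of continuous images of closed
  sets in a Polish space is not separable, then after covering one \<open>F\<^sub>i\<close> by countably many small balls, it
  may be replaced by its intersection with one of them without making the sequence separable.
  Iterating, every \<open>F\<^sub>n\<close> shrinks to a point \<open>z\<^sub>n\<close>.  As the \<open>f(z\<^sub>n)\<close> are not all equal, two of them
  have disjoint open neighbourhoods, which separate the sequence at a finite stage.
\<close>

section \<open>Polish spaces\<close>

lemma second_countable_prod_topology:
  assumes "second_countable X" "second_countable Y"
  shows "second_countable (prod_topology X Y)"
proof -
  obtain B where B: "countable B" "\<And>V. V \<in> B \<Longrightarrow> openin X V"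
      "\<And>U x. openin X U \<Longrightarrow> x \<in> U \<Longrightarrow> \<exists>V\<in>B. x \<in> V \<and> V \<subseteq> U"
    using assms(1)[unfolded second_countable_def] by auto
  obtain C where C: "countable C" "\<And>V. V \<in> C \<Longrightarrow> openin Y V"
      "\<And>U x. openin Y U \<Longrightarrow> x \<in> U \<Longrightarrow> \<exists>V\<in>C. x \<in> V \<and> V \<subseteq> U"
    using assms(2)[unfolded second_countable_def] by auto
  have "\<exists>V\<in>(\<lambda>(b, c). b \<times> c) ` (B \<times> C). p \<in> V \<and> V \<subseteq> U"
    if U: "openin (prod_topology X Y) U" "p \<in> U" for U p
  proof -
    have "(fst p, snd p) \<in> U" using U(2) by simp
    then obtain a b where ab: "openin X a" "openin Y b" "fst p \<in> a" "snd p \<in> b" "a \<times> b \<subseteq> U"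
      using U(1) unfolding openin_prod_topology_alt by meson
    obtain V W where "V \<in> B" "fst p \<in> V" "V \<subseteq> a" "W \<in> C" "snd p \<in> W" "W \<subseteq> b"
      using B(3)[OF ab(1,3)] C(3)[OF ab(2,4)] by blast
    then show ?thesis
      using ab(5) by (intro bexI[of _ "V \<times> W"]) (auto simp: mem_Times_iff)
  qed
  moreover have "countable ((\<lambda>(b, c). b \<times> c) ` (B \<times> C))"
    using B(1) C(1) by simp
  moreover have "\<forall>V \<in> (\<lambda>(b, c). b \<times> c) ` (B \<times> C). openin (prod_topology X Y) V"
    using B(2) C(2) by (auto simp: openin_prod_Times_iff)
  ultimately show ?thesis
    unfolding second_countable_def
    by (intro exI[of _ "(\<lambda>(b, c). b \<times> c) ` (B \<times> C)"] conjI allI impI) auto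
qed

lemma second_countable_euclidean:
  "second_countable (euclidean :: 'a::second_countable_topology topology)"
proof -
  obtain B :: "'a set set" where B: "countable B" "topological_basis B"
    using ex_countable_basis by blast
  have "\<exists>V\<in>B. x \<in> V \<and> V \<subseteq> U" if "open U" "x \<in> U" for U x
    using topological_basisE[OF B(2) that] by metis
  then show ?thesis
    unfolding second_countable_def open_openin[symmetric]
    using B(1) topological_basis_open[OF B(2)] by blast
qed

lemma completely_metrizable_Baire_space:
  "completely_metrizable_space (euclidean :: (nat \<Rightarrow> nat) topology)"
proof -
  have "(euclidean :: nat topology) = discrete_topology UNIV"
    by (metis discrete_topology_unique open_discrete open_openin topspace_euclidean)
  then show ?thesis
    by (simp flip: euclidean_product_topology
        add: completely_metrizable_space_product_topology completely_metrizable_space_discrete_topology)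
qed

section \<open>Novikov separation\<close>

text \<open>Novikov's form of separation. If all sets but two are \<open>space M\<close>, this is
  Lusin's separation of those two by disjoint measurable sets.\<close>

definition Borel_separable :: "'a measure \<Rightarrow> (nat \<Rightarrow> 'a set) \<Rightarrow> bool" where
  "Borel_separable M A \<longleftrightarrow>
    (\<exists>C. (\<forall>n. C n \<in> sets M \<and> A n \<subseteq> C n) \<and> (\<Inter>n. C n) = {})"

text \<open>Used in contrapositive form: every member of a nonseparable sequence of subsets of
  \<open>space M\<close> is nonempty.\<close>

lemma Borel_separable_empty:
  assumes "A i = {}" "\<And>n. A n \<subseteq> space M"
  shows "Borel_separable M A"
  unfolding Borel_separable_def using assms
  by (intro exI[of _ "(\<lambda>n. space M)(i := {})"]) (auto split: if_splits)

lemma Borel_separable_disjoint: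
  assumes "i \<noteq> j" "A i \<subseteq> U" "A j \<subseteq> V" "U \<inter> V = {}" "U \<in> sets M" "V \<in> sets M"
    "\<And>n. A n \<subseteq> space M"
  shows "Borel_separable M A"
  unfolding Borel_separable_def
proof (intro exI[of _ "(\<lambda>n. space M)(i := U, j := V)"] conjI allI)
  show "(\<Inter>n. ((\<lambda>n. space M)(i := U, j := V)) n) = {}"
  proof (rule equals0I)
    fix x assume "x \<in> (\<Inter>n. ((\<lambda>n. space M)(i := U, j := V)) n)"
    then have "x \<in> ((\<lambda>n. space M)(i := U, j := V)) n" for n by blast
    from this[of i] this[of j] show False using assms(1,4) by auto
  qed
qed (use assms in auto)

text \<open>At index \<open>i\<close> the hulls obtained for the pieces are united, at every other
  index they are intersected. A point common to all the results lies in \<open>C k i\<close> for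
  some \<open>k\<close>, hence in every \<open>C k n\<close> with this same \<open>k\<close>, which
  is impossible.\<close>

lemma Borel_separable_Union:
  assumes "countable I" "I \<noteq> {}" "\<And>k. k \<in> I \<Longrightarrow> Borel_separable M (A(i := B k))"
    "A i \<subseteq> (\<Union>k\<in>I. B k)"
  shows "Borel_separable M A"
proof -
  obtain C where C: "\<And>k n. k \<in> I \<Longrightarrow> C k n \<in> sets M"
      "\<And>k n. k \<in> I \<Longrightarrow> (A(i := B k)) n \<subseteq> C k n" "\<And>k. k \<in> I \<Longrightarrow> (\<Inter>n. C k n) = {}"
    using assms(3) unfolding Borel_separable_def by metis
  define D where "D n = (if n = i then \<Union>k\<in>I. C k n else \<Inter>k\<in>I. C k n)" for n
  have "D n \<in> sets M" for n
    unfolding D_def using assms(1,2) C(1) by (auto intro!: sets.countable_INT' sets.countable_UN')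
  moreover have "A n \<subseteq> D n" for n
  proof (cases "n = i")
    case True
    have "B k \<subseteq> C k i" if "k \<in> I" for k using C(2)[OF that, of i] by simp
    then show ?thesis using assms(4) True unfolding D_def by fastforce
  next
    case False
    have "A n \<subseteq> C k n" if "k \<in> I" for k using C(2)[OF that, of n] False by simp
    then show ?thesis using False unfolding D_def by auto
  qed
  moreover have "(\<Inter>n. D n) = {}"
  proof (rule ccontr)
    assume "(\<Inter>n. D n) \<noteq> {}"
    then obtain x where x: "\<And>n. x \<in> D n" by auto
    then obtain k where k: "k \<in> I" "x \<in> C k i" using x[of i] unfolding D_def by auto
    have "x \<in> C k n" for n
      using x[of n] k unfolding D_def by (cases "n = i") auto
    then show False using C(3)[OF k(1)] by auto
  qed
  ultimately show ?thesis unfolding Borel_separable_def by blast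
qed

text \<open>Lindelof property applied to the open balls of radius \<open>e\<close>. Closed balls are
  recorded because cutting a closed set with them leaves it closed.\<close>

lemma (in Metric_space) countable_mcball_cover:
  assumes "second_countable mtopology" "e > 0"
  obtains I where "countable I" "M \<subseteq> (\<Union>c\<in>I. mcball c e)"
proof -
  have Lindelof: "Lindelof_space mtopology" using assms(1) by (rule second_countable_imp_Lindelof_space)
  have "\<Union>((\<lambda>c. mball c e) ` M) = topspace mtopology" using assms(2) by auto
  then obtain V where V: "countable V" "V \<subseteq> (\<lambda>c. mball c e) ` M" "\<Union>V = topspace mtopology"
    using Lindelof_spaceD[OF Lindelof, of "(\<lambda>c. mball c e) ` M"] openin_mball by (metis imageE)
  then obtain I where I: "countable I" "V = (\<lambda>c. mball c e) ` I"
    by (metis countable_subset_image)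
  have "M \<subseteq> (\<Union>c\<in>I. mball c e)" using V(3) I(2) by simp
  also have "\<dots> \<subseteq> (\<Union>c\<in>I. mcball c e)" by (intro UN_mono mball_subset_mcball order_refl)
  finally show thesis using I(1) that by blast
qed

theorem Novikov_separation:
  fixes F :: "nat \<Rightarrow> 'z set"
  assumes Z: "completely_metrizable_space Z" "second_countable Z"
    and f: "continuous_map Z X f" and X: "Hausdorff_space X"
    and M: "space M = topspace X" "\<And>U. openin X U \<Longrightarrow> U \<in> sets M"
    and F: "\<And>n. closedin Z (F n)" and empty: "(\<Inter>n. f ` F n) = {}"
  shows "Borel_separable M (\<lambda>n. f ` F n)"
proof (rule ccontr)
  assume nonsep: "\<not> Borel_separable M (\<lambda>n. f ` F n)"
  obtain S d where "Metric_space S d" "Metric_space.mcomplete S d"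
    and Zeq: "Z = Metric_space.mtopology S d"
    using Z(1) unfolding completely_metrizable_space_def by blast
  then interpret Metric_space S d by simp
  have mcomplete: mcomplete by fact
  \<comment> \<open>Invariant of the iteration: closedness serves the nested-set argument,
    nonseparability keeps the sets nonempty and is refuted at the end.\<close>
  define P where "P K \<longleftrightarrow> (\<forall>n. closedin Z (K n)) \<and> \<not> Borel_separable M (\<lambda>n. f ` K n)"
    for K :: "nat \<Rightarrow> 'z set"
  (* Step k shrinks only the set with index fst (prod_decode k), so that along the iteration every
     index is treated with every radius 1/(j+1). *)
  define R where "R k K K' \<longleftrightarrow> (\<forall>n. K' n \<subseteq> K n) \<and>
      (\<exists>c. K' (fst (prod_decode k)) \<subseteq> mcball c (inverse (Suc (snd (prod_decode k)))))"
    for k and K K' :: "nat \<Rightarrow> 'z set"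
  have sub: "f ` K n \<subseteq> space M" if "P K" for K n
    using that continuous_map_image_subset_topspace[OF f] closedin_subset
    unfolding P_def M(1) by blast
  have step: "\<exists>K'. P K' \<and> R k K K'" if K: "P K" for k K
  proof -
    define i e where "i = fst (prod_decode k)" and "e = inverse (real (Suc (snd (prod_decode k))))"
    have "e > 0" unfolding e_def by simp
    obtain I where I: "countable I" "S \<subseteq> (\<Union>c\<in>I. mcball c e)"
      using countable_mcball_cover[OF Z(2)[unfolded Zeq] \<open>e > 0\<close>] .
    have "K i \<subseteq> S" using K closedin_subset unfolding P_def Zeq by fastforce
    have "K i \<noteq> {}" using Borel_separable_empty[of "\<lambda>n. f ` K n" i] K sub[OF K] unfolding P_def by blast
    then have "I \<noteq> {}" using I(2) \<open>K i \<subseteq> S\<close> by auto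
    have "\<exists>c\<in>I. \<not> Borel_separable M (\<lambda>n. f ` (K(i := K i \<inter> mcball c e)) n)"
    proof (rule ccontr)
      assume "\<not> ?thesis"
      moreover have "(\<lambda>n. f ` (K(i := K i \<inter> mcball c e)) n) =
          (\<lambda>n. f ` K n)(i := f ` (K i \<inter> mcball c e))" for c by (simp add: fun_eq_iff)
      ultimately have "\<forall>c\<in>I. Borel_separable M ((\<lambda>n. f ` K n)(i := f ` (K i \<inter> mcball c e)))"
        by simp
      then have sep: "Borel_separable M ((\<lambda>n. f ` K n)(i := f ` (K i \<inter> mcball c e)))" if "c \<in> I" for c
        using that by (rule bspec)
      have cover: "f ` K i \<subseteq> (\<Union>c\<in>I. f ` (K i \<inter> mcball c e))"
      proof (rule image_subsetI)
        fix y assume "y \<in> K i"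
        then have "y \<in> (\<Union>c\<in>I. mcball c e)" using \<open>K i \<subseteq> S\<close> I(2) by (metis subsetD)
        then obtain c where "c \<in> I" "y \<in> mcball c e" by (rule UN_E)
        then show "f y \<in> (\<Union>c\<in>I. f ` (K i \<inter> mcball c e))"
          using \<open>y \<in> K i\<close> by (intro UN_I[of c] imageI IntI)
      qed
      have "Borel_separable M (\<lambda>n. f ` K n)"
        by (rule Borel_separable_Union[OF I(1) \<open>I \<noteq> {}\<close> sep cover])
      then show False using K unfolding P_def by blast
    qed
    then obtain c where "\<not> Borel_separable M (\<lambda>n. f ` (K(i := K i \<inter> mcball c e)) n)" ..
    then show ?thesis
      using K by (intro exI[of _ "K(i := K i \<inter> mcball c e)"])
        (auto simp: P_def R_def i_def e_def Zeq intro!: exI[of _ c])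
  qed
  have "P F" unfolding P_def using F nonsep by auto
  \<comment> \<open>The clause on \<open>k = 0\<close> makes the chosen sequence start at
    \<open>F\<close>.\<close>
  then obtain K where K: "\<And>k. P (K k)" "\<And>k. R k (K k) (K (Suc k))" "K 0 = F"
    using dependent_nat_choice[of "\<lambda>k K. P K \<and> (k = 0 \<longrightarrow> K = F)" R] step by (auto 4 3)
  have decseq: "decseq (\<lambda>k. K k n)" for n
    using K(2) unfolding R_def by (intro decseq_SucI) blast
  have mono: "K l n \<subseteq> K k n" if "k \<le> l" for k l n
    using decseqD[OF decseq that] .
  have small: "\<exists>k c. K k n \<subseteq> mcball c e" if "e > 0" for n e
  proof -
    obtain j where j: "inverse (real (Suc j)) < e" using reals_Archimedean \<open>e > 0\<close> by blast
    \<comment> \<open>Step \<open>prod_encode (n, j)\<close> cuts the set of index \<open>n\<close>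
      with a ball of radius 1/(j+1); its effect is visible from the next stage on.\<close>
    obtain c where "K (Suc (prod_encode (n, j))) n \<subseteq> mcball c (inverse (real (Suc j)))"
      using K(2)[of "prod_encode (n, j)"] unfolding R_def by auto
    also have "\<dots> \<subseteq> mcball c e" using j by (intro mcball_subset_concentric) simp
    finally show ?thesis by blast
  qed
  have "\<exists>z. \<forall>k. z \<in> K k n" for n
  proof -
    \<comment> \<open>Cantor's intersection theorem, as a characterisation of completeness.\<close>
    have "\<Inter> (range (\<lambda>k. K k n)) \<noteq> {}"
    proof (rule mcomplete[unfolded mcomplete_nest, rule_format], intro conjI allI impI)
      show "closedin mtopology (K k n)" for k using K(1) unfolding P_def Zeq by blast
      show "K k n \<noteq> {}" for k
        using Borel_separable_empty[of "\<lambda>n. f ` K k n" n] K(1)[of k] sub[OF K(1)] unfolding P_def by fast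
      show "decseq (\<lambda>k. K k n)" by (rule decseq)
      show "\<exists>k c. K k n \<subseteq> mcball c e" if "e > 0" for e using small that by blast
    qed
    then show ?thesis by auto
  qed
  then obtain z where z: "\<And>n k. z n \<in> K k n" by metis
  then have zF: "z n \<in> F n" for n using K(3) by metis
  have zS: "z n \<in> S" for n using zF F closedin_subset unfolding Zeq by fastforce
  have "f (z 0) \<notin> (\<Inter>n. f ` F n)" using empty by blast
  then obtain j where j: "f (z 0) \<noteq> f (z j)" using zF by fastforce
  then have "0 \<noteq> j" by metis
  have "f (z n) \<in> topspace X" for n using sub[OF K(1)] z M(1) by blast
  then obtain U V where UV: "openin X U" "openin X V" "f (z 0) \<in> U" "f (z j) \<in> V" "disjnt U V"
    using X j unfolding Hausdorff_space_def by metis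
  have image_small: "\<exists>k. f ` K k n \<subseteq> W" if W: "openin X W" "f (z n) \<in> W" for n W
  proof -
    have "openin mtopology {x \<in> topspace Z. f x \<in> W}"
      using openin_continuous_map_preimage[OF f W(1)] unfolding Zeq .
    moreover have "z n \<in> {x \<in> topspace Z. f x \<in> W}" using zS W(2) unfolding Zeq by simp
    ultimately obtain r where r: "r > 0" "mball (z n) r \<subseteq> {x \<in> topspace Z. f x \<in> W}"
      unfolding openin_mtopology by blast
    \<comment> \<open>The centre \<open>c\<close> need not be \<open>z n\<close>, but two points of
      a closed ball of radius r/3 are at distance at most 2r/3 < r.\<close>
    obtain k c where kc: "K k n \<subseteq> mcball c (r/3)" using small[of "r/3" n] r(1) by auto
    have "K k n \<subseteq> mball (z n) r"
    proof
      fix y assume "y \<in> K k n"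
      then have "y \<in> mcball c (r/3)" "z n \<in> mcball c (r/3)" using kc z by blast+
      then have "y \<in> S" "c \<in> S" "d c y \<le> r/3" "d c (z n) \<le> r/3" by auto
      then have "d (z n) y < r"
        using triangle[of "z n" c y] zS commute[of c "z n"] r(1) by auto
      then show "y \<in> mball (z n) r" using zS \<open>y \<in> S\<close> by auto
    qed
    then show ?thesis using r(2) by blast
  qed
  obtain k where k: "f ` K k 0 \<subseteq> U" using image_small[OF UV(1,3)] by blast
  obtain l where l: "f ` K l j \<subseteq> V" using image_small[OF UV(2,4)] by blast
  have "f ` K (max k l) 0 \<subseteq> U" "f ` K (max k l) j \<subseteq> V"
    using order_trans[OF image_mono[OF mono] k, of "max k l"]
      order_trans[OF image_mono[OF mono] l, of "max k l"] by simp_all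
  then have "Borel_separable M (\<lambda>n. f ` K (max k l) n)"
    using UV(5) M(2)[OF UV(1)] M(2)[OF UV(2)] sub[OF K(1)]
    by (intro Borel_separable_disjoint[OF \<open>0 \<noteq> j\<close>, where U = U and V = V]) (simp_all add: disjnt_def)
  then show False using K(1)[of "max k l"] unfolding P_def by blast
qed

section \<open>Analytic sets\<close>

abbreviation Baire :: "(nat \<Rightarrow> nat) topology" where
  "Baire \<equiv> euclidean"

text \<open>For Polish \<open>Y\<close> these are the classical analytic (Suslin) sets. The Baire
  coordinate is a witness of membership; the closure properties below recode witnesses.\<close>

definition analytic_in :: "'a topology \<Rightarrow> 'a set \<Rightarrow> bool" where
  "analytic_in Y A \<longleftrightarrow> (\<exists>F. closedin (prod_topology Y Baire) F \<and> A = fst ` F)"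

lemma analytic_in_closedin:
  assumes "closedin Y A"
  shows "analytic_in Y A"
proof -
  have "closedin (prod_topology Y Baire) (A \<times> UNIV)"
    using assms by (simp add: closedin_prod_Times_iff)
  then show ?thesis unfolding analytic_in_def by (intro exI[of _ "A \<times> UNIV"]) auto
qed

text \<open>Recoding a witness by \<open>g\<close> while fixing the point is continuous, so
  conditions of the form "the recoded pair lies in a closed set" are closed.\<close>

lemma continuous_map_on_witness:
  assumes "continuous_on UNIV g"
  shows "continuous_map (prod_topology Y Baire) (prod_topology Y Baire) (\<lambda>p. (fst p, g (snd p)))"
proof -
  have "continuous_map Baire Baire g" using assms by simp
  then have "continuous_map (prod_topology Y Baire) Baire (g \<circ> snd)"
    by (rule continuous_map_compose[OF continuous_map_snd])
  then show ?thesis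
    using continuous_map_fst by (auto simp: continuous_map_pairwise o_def)
qed

text \<open>The first entry of a witness names a set containing the point; the remaining entries
  form a witness for that set.\<close>

lemma analytic_in_UN:
  fixes A :: "nat \<Rightarrow> 'a set"
  assumes "\<And>n. analytic_in Y (A n)"
  shows "analytic_in Y (\<Union>n. A n)"
proof -
  let ?Z = "prod_topology Y Baire"
  obtain F where F: "\<And>n. closedin ?Z (F n)" "\<And>n. A n = fst ` F n"
    using assms unfolding analytic_in_def by metis
  let ?tl = "\<lambda>p :: 'a \<times> (nat \<Rightarrow> nat). (fst p, \<lambda>k. snd p (Suc k))"
  define G where "G = {p \<in> topspace ?Z. ?tl p \<in> F (snd p 0)}"
  have tl: "continuous_map ?Z ?Z ?tl"
    by (rule continuous_map_on_witness) (intro continuous_on_coordinatewise_then_product, simp)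
  have open_slice: "openin ?Z {p \<in> topspace ?Z. snd p 0 = n}" for n
  proof -
    have "open ((\<lambda>\<sigma> :: nat \<Rightarrow> nat. \<sigma> 0) -` {n})"
      by (rule open_vimage) (simp_all add: open_discrete)
    then have "openin ?Z {p \<in> topspace ?Z. snd p \<in> (\<lambda>\<sigma>. \<sigma> 0) -` {n}}"
      by (intro openin_continuous_map_preimage[OF continuous_map_snd]) simp
    then show ?thesis by simp
  qed
  have open_tl: "openin ?Z {p \<in> topspace ?Z. ?tl p \<in> topspace ?Z - F n}" for n
    by (rule openin_continuous_map_preimage[OF tl openin_diff[OF openin_topspace F(1)]])
  \<comment> \<open>The closed set to be tested depends on the first entry \<open>n\<close>, which
    is locally constant. Slicing by its value exhibits the complement of \<open>G\<close> as a union
    of open sets.\<close>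
  have "topspace ?Z - G = (\<Union>n. {p \<in> topspace ?Z. snd p 0 = n} \<inter>
          {p \<in> topspace ?Z. ?tl p \<in> topspace ?Z - F n})"
    unfolding G_def by auto
  then have "openin ?Z (topspace ?Z - G)"
    using open_slice open_tl by (metis (no_types, lifting) openin_Int openin_Union image_iff)
  moreover have "G \<subseteq> topspace ?Z" unfolding G_def by blast
  ultimately have "closedin ?Z G" unfolding closedin_def by blast
  moreover have "fst ` G = (\<Union>n. A n)"
  proof (intro equalityI subsetI)
    fix x assume "x \<in> fst ` G"
    then obtain \<sigma> where "(x, \<lambda>k. \<sigma> (Suc k)) \<in> F (\<sigma> 0)" unfolding G_def by auto
    then show "x \<in> (\<Union>n. A n)" unfolding F(2) by force
  next
    fix x assume "x \<in> (\<Union>n. A n)"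
    then obtain n \<sigma> where \<sigma>: "(x, \<sigma>) \<in> F n" unfolding F(2) by auto
    then have "x \<in> topspace Y" using closedin_subset[OF F(1)] by fastforce
    then have "(x, case_nat n \<sigma>) \<in> G" unfolding G_def using \<sigma> by simp
    then show "x \<in> fst ` G" by force
  qed
  ultimately show ?thesis unfolding analytic_in_def by blast
qed

text \<open>One sequence codes countably many via \<open>prod_encode\<close>; its row
  \<open>n\<close> is the witness for \<open>A n\<close>.\<close>

lemma analytic_in_INT:
  fixes A :: "nat \<Rightarrow> 'a set"
  assumes "\<And>n. analytic_in Y (A n)"
  shows "analytic_in Y (\<Inter>n. A n)"
proof -
  let ?Z = "prod_topology Y Baire"
  obtain F where F: "\<And>n. closedin ?Z (F n)" "\<And>n. A n = fst ` F n"
    using assms unfolding analytic_in_def by metis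
  let ?row = "\<lambda>n (p :: 'a \<times> (nat \<Rightarrow> nat)). (fst p, \<lambda>k. snd p (prod_encode (n, k)))"
  define G where "G = (\<Inter>n. {p \<in> topspace ?Z. ?row n p \<in> F n})"
  have "continuous_map ?Z ?Z (?row n)" for n
    by (rule continuous_map_on_witness) (intro continuous_on_coordinatewise_then_product, simp)
  then have "closedin ?Z {p \<in> topspace ?Z. ?row n p \<in> F n}" for n
    using F(1) by (rule closedin_continuous_map_preimage)
  then have "closedin ?Z G" unfolding G_def by blast
  moreover have "fst ` G = (\<Inter>n. A n)"
  proof (intro equalityI subsetI)
    fix x assume "x \<in> fst ` G"
    then obtain \<sigma> where "\<And>n. (x, \<lambda>k. \<sigma> (prod_encode (n, k))) \<in> F n" unfolding G_def by auto
    then show "x \<in> (\<Inter>n. A n)" unfolding F(2) by force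
  next
    fix x assume "x \<in> (\<Inter>n. A n)"
    then have "\<exists>\<sigma>. (x, \<sigma>) \<in> F n" for n unfolding F(2) by force
    then obtain \<sigma> where \<sigma>: "\<And>n. (x, \<sigma> n) \<in> F n" by metis
    then have "x \<in> topspace Y" using closedin_subset[OF F(1)] by fastforce
    then have "(x, \<lambda>m. case_prod \<sigma> (prod_decode m)) \<in> G" unfolding G_def using \<sigma> by simp
    then show "x \<in> fst ` G" by force
  qed
  ultimately show ?thesis unfolding analytic_in_def by blast
qed

text \<open>Analytic sets are in general not closed under complement, so the induction carries a set
  together with its complement. It starts because open sets of a metrizable space are countable
  unions of closed sets.\<close>

lemma analytic_in_Borel:
  assumes Y: "metrizable_space Y" and A: "A \<in> sigma_sets (topspace Y) {U. openin Y U}"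
  shows "analytic_in Y A"
proof -
  have "analytic_in Y A \<and> analytic_in Y (topspace Y - A)"
    using A
  proof (induction rule: sigma_sets.induct)
    case (Basic U)
    then have U: "openin Y U" by simp
    then have "fsigma_in Y U" using Y by (rule open_imp_fsigma_in[rotated])
    then obtain T where "\<And>n :: nat. closedin Y (T n)" "\<Union>(range T) = U"
      unfolding fsigma_in_def by (auto simp: countable_union_of_explicit)
    then have "analytic_in Y U" using analytic_in_UN[of Y T] analytic_in_closedin by blast
    moreover have "analytic_in Y (topspace Y - U)" using U by (intro analytic_in_closedin) blast
    ultimately show ?case ..
  next
    case Empty
    then show ?case by (simp add: analytic_in_closedin)
  next
    case (Compl a)
    moreover have "topspace Y - (topspace Y - a) = a"
      using sigma_sets_into_sp[OF _ Compl.hyps] openin_subset by blast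
    ultimately show ?case by simp
  next
    case (Union a)
    have "topspace Y - (\<Union>i. a i) = (\<Inter>i. topspace Y - a i)" by blast
    then show ?case using analytic_in_UN[of Y a] analytic_in_INT[of Y "\<lambda>i. topspace Y - a i"] Union
      by simp
  qed
  then show ?thesis ..
qed

text \<open>Each \<open>E n\<close> is Borel in the product space \<open>Y\<close>, hence the
  projection of a closed \<open>F n\<close> in \<open>Y\<close> times Baire space. Projecting once
  more to the state space puts the sequence into the form required by
  \<open>Novikov_separation\<close>.\<close>

lemma Borel_separable_projections:
  fixes E :: "nat \<Rightarrow> ('a \<times> real) set"
  assumes M: "standard_borel M" and E: "\<And>n. E n \<in> sets (M \<Otimes>\<^sub>M borel)"
    and empty: "(\<Inter>n. fst ` E n) = {}"
  shows "Borel_separable M (\<lambda>n. fst ` E n)"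
proof -
  obtain X where X: "completely_metrizable_space X" "second_countable X"
    and space_M: "topspace X = space M" and sets_M: "sets M = sigma_sets (topspace X) {U. openin X U}"
    using M unfolding standard_borel_def by blast
  define Y where "Y = prod_topology X euclideanreal"
  define Z where "Z = prod_topology Y Baire"
  define N where "N = sigma (topspace Y) {U. openin Y U}"
  have sub: "{U. openin Y U} \<subseteq> Pow (topspace Y)" using openin_subset by blast
  then have N: "space N = topspace Y" "sets N = sigma_sets (topspace Y) {U. openin Y U}"
    unfolding N_def by (simp_all add: space_measure_of sets_measure_of)
  have Y: "completely_metrizable_space Y" "second_countable Y"
    unfolding Y_def using X
    by (simp_all add: completely_metrizable_space_prod_topology completely_metrizable_space_euclidean
        second_countable_prod_topology second_countable_euclidean)
  have Z: "completely_metrizable_space Z" "second_countable Z"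
    unfolding Z_def using Y
    by (simp_all add: completely_metrizable_space_prod_topology completely_metrizable_Baire_space
        second_countable_prod_topology second_countable_euclidean)
  have fst_Y: "continuous_map Y X fst" and snd_Y: "continuous_map Y euclideanreal snd"
    unfolding Y_def by (rule continuous_map_fst continuous_map_snd)+
  \<comment> \<open>The aim is to include the product sigma-algebra in the Borel sigma-algebra of
    \<open>Y\<close>: the identity, written as a pair of projections, is measurable from
    \<open>N\<close> to the product.\<close>
  have "fst \<in> measurable N M"
  proof (rule measurable_sigma_sets[OF sets_M])
    show "{U. openin X U} \<subseteq> Pow (topspace X)" using openin_subset by blast
    show "fst \<in> space N \<rightarrow> topspace X" unfolding N Y_def by auto
    show "fst -` U \<inter> space N \<in> sets N" if "U \<in> {U. openin X U}" for U
    proof -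
      have "openin Y {p \<in> topspace Y. fst p \<in> U}"
        using that by (intro openin_continuous_map_preimage[OF fst_Y]) simp
      moreover have "fst -` U \<inter> space N = {p \<in> topspace Y. fst p \<in> U}" unfolding N by blast
      ultimately show ?thesis unfolding N(2) by (intro sigma_sets.Basic) simp
    qed
  qed
  moreover have "snd \<in> borel_measurable N"
  proof (rule borel_measurableI)
    fix U :: "real set" assume "open U"
    then have "openin Y {p \<in> topspace Y. snd p \<in> U}"
      by (intro openin_continuous_map_preimage[OF snd_Y]) simp
    moreover have "snd -` U \<inter> space N = {p \<in> topspace Y. snd p \<in> U}" unfolding N by blast
    ultimately show "snd -` U \<inter> space N \<in> sets N" unfolding N(2) by (intro sigma_sets.Basic) simp
  qed
  ultimately have "(\<lambda>p. (fst p, snd p)) \<in> measurable N (M \<Otimes>\<^sub>M borel)"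
    by (rule measurable_Pair)
  then have "(\<lambda>p. (fst p, snd p)) -` E n \<inter> space N \<in> sets N" for n
    using E by (rule measurable_sets)
  moreover have "E n \<subseteq> space N" for n
    using sets.sets_into_space[OF E[of n]] unfolding N Y_def by (simp add: space_pair_measure space_M)
  ultimately have "E n \<in> sigma_sets (topspace Y) {U. openin Y U}" for n
    unfolding N(2)[symmetric] by (simp add: Int_absorb2)
  then have "analytic_in Y (E n)" for n
    using completely_metrizable_imp_metrizable_space[OF Y(1)] by (intro analytic_in_Borel)
  then obtain F where F: "\<And>n. closedin Z (F n)" "\<And>n. E n = fst ` F n"
    unfolding analytic_in_def Z_def by metis
  have "Borel_separable M (\<lambda>n. (fst \<circ> fst) ` F n)"
  proof (rule Novikov_separation[OF Z])
    show "continuous_map Z X (fst \<circ> fst)"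
      unfolding Z_def by (rule continuous_map_compose[OF continuous_map_fst fst_Y])
    show "Hausdorff_space X"
      using X(1) completely_metrizable_imp_metrizable_space metrizable_imp_Hausdorff_space by blast
    show "U \<in> sets M" if "openin X U" for U
      unfolding sets_M using that by (intro sigma_sets.Basic) simp
    show "(\<Inter>n. (fst \<circ> fst) ` F n) = {}"
      using empty unfolding F(2) image_comp .
  qed (simp_all add: space_M F(1))
  then show ?thesis unfolding F(2) image_comp .
qed

section \<open>Signed kernels\<close>

lemma signed_measure_Un:
  assumes \<mu>: "signed_measure M \<mu>" and A: "A \<in> sets M" and B: "B \<in> sets M" and "A \<inter> B = {}"
  shows "\<mu> (A \<union> B) = \<mu> A + \<mu> B"
proof -
  have "disjoint_family (binaryset A B)"
    using \<open>A \<inter> B = {}\<close> by (auto simp: disjoint_family_on_def binaryset_def)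
  moreover have "range (binaryset A B) \<subseteq> sets M"
    using A B by (simp add: range_binaryset_eq)
  ultimately have "(\<lambda>i. \<mu> (binaryset A B i)) sums \<mu> (A \<union> B)"
    using \<mu> unfolding signed_measure_def UN_binaryset_eq[symmetric] by blast
  moreover have "(\<lambda>i. \<mu> (binaryset A B i)) sums (\<mu> A + \<mu> B)"
    using \<mu> unfolding signed_measure_def by (intro binaryset_sums) simp
  ultimately show ?thesis by (rule sums_unique2)
qed

text \<open>Countable additivity replaces monotonicity: \<open>A 0\<close> is the disjoint union of
  the intersection and the differences \<open>D i\<close>, whose values telescope.\<close>

lemma signed_measure_decseq:
  assumes \<mu>: "signed_measure M \<mu>" and A: "range A \<subseteq> sets M" and "decseq A"
  shows "(\<lambda>n. \<mu> (A n)) \<longlonglongrightarrow> \<mu> (\<Inter>n. A n)"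
proof -
  define D where "D n = A n - A (Suc n)" for n
  have A_sets: "A n \<in> sets M" for n using A by blast
  have D_sets: "D n \<in> sets M" for n unfolding D_def using A_sets by blast
  have I_sets: "(\<Inter>n. A n) \<in> sets M" using A_sets by blast
  have disj: "D m \<inter> D n = {}" if "m < n" for m n
    using decseqD[OF \<open>decseq A\<close>, of "Suc m" n] that unfolding D_def by auto
  have "disjoint_family D"
    unfolding disjoint_family_on_def by (metis disj inf_commute linorder_neqE_nat)
  then have sums: "(\<lambda>i. \<mu> (D i)) sums \<mu> (\<Union>i. D i)"
    using \<mu> D_sets unfolding signed_measure_def by blast
  have "\<mu> (D n) = \<mu> (A n) - \<mu> (A (Suc n))" for n
  proof -
    have "A (Suc n) \<union> D n = A n"
      unfolding D_def using decseqD[OF \<open>decseq A\<close>, of n "Suc n"] by auto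
    then show ?thesis
      using signed_measure_Un[OF \<mu> A_sets[of "Suc n"] D_sets[of n]] unfolding D_def by auto
  qed
  then have partial: "(\<Sum>i<n. \<mu> (D i)) = \<mu> (A 0) - \<mu> (A n)" for n
    by (induction n) simp_all
  have "A 0 = (\<Inter>n. A n) \<union> (\<Union>i. D i)"
  proof (intro equalityI subsetI)
    fix x assume x: "x \<in> A 0"
    show "x \<in> (\<Inter>n. A n) \<union> (\<Union>i. D i)"
    proof (rule ccontr)
      assume neg: "\<not> ?thesis"
      have "x \<in> A n" for n by (induction n) (use x neg in \<open>auto simp: D_def\<close>)
      then show False using neg by blast
    qed
  next
    fix x assume "x \<in> (\<Inter>n. A n) \<union> (\<Union>i. D i)"
    then obtain n where "x \<in> A n" unfolding D_def by blast
    then show "x \<in> A 0" using decseqD[OF \<open>decseq A\<close>, of 0 n] by blast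
  qed
  moreover have "\<mu> ((\<Inter>n. A n) \<union> (\<Union>i. D i)) = \<mu> (\<Inter>n. A n) + \<mu> (\<Union>i. D i)"
    using D_sets I_sets by (intro signed_measure_Un[OF \<mu>]) (auto simp: D_def)
  ultimately have total: "\<mu> (A 0) - \<mu> (\<Union>i. D i) = \<mu> (\<Inter>n. A n)" by simp
  have "(\<lambda>n. \<mu> (A 0) - (\<Sum>i<n. \<mu> (D i))) \<longlonglongrightarrow> \<mu> (A 0) - \<mu> (\<Union>i. D i)"
    using sums unfolding sums_def by (intro tendsto_diff tendsto_const)
  then show ?thesis unfolding partial total by simp
qed

lemma standard_borel_separating_sequence:
  assumes "standard_borel M"
  obtains U :: "nat \<Rightarrow> 'a set" where "range U \<subseteq> sets M"
    "\<And>x y. x \<in> space M \<Longrightarrow> y \<in> space M \<Longrightarrow> x \<noteq> y \<Longrightarrow> \<exists>k. x \<in> U k \<and> y \<notin> U k"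
proof -
  obtain X where X: "completely_metrizable_space X" "second_countable X"
    and space_M: "topspace X = space M" and sets_M: "sets M = sigma_sets (topspace X) {U. openin X U}"
    using assms unfolding standard_borel_def by blast
  obtain B where B: "countable B" "\<And>V. V \<in> B \<Longrightarrow> openin X V"
      "\<And>U x. openin X U \<Longrightarrow> x \<in> U \<Longrightarrow> \<exists>V\<in>B. x \<in> V \<and> V \<subseteq> U"
    using X(2)[unfolded second_countable_def] by auto
  \<comment> \<open>The inserted empty set guarantees that there is something to enumerate, even if
    \<open>B\<close> is empty.\<close>
  define U where "U = from_nat_into (insert {} B)"
  have range_U: "range U = insert {} B"
    unfolding U_def using B(1) by (intro range_from_nat_into) simp_all
  have "openin X V" if "V \<in> range U" for V using that B(2) unfolding range_U by auto
  then have "range U \<subseteq> sets M" unfolding sets_M by (blast intro: sigma_sets.Basic)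
  moreover have "\<exists>k. x \<in> U k \<and> y \<notin> U k" if xy: "x \<in> space M" "y \<in> space M" "x \<noteq> y" for x y
  proof -
    have "Hausdorff_space X"
      using X(1) completely_metrizable_imp_metrizable_space metrizable_imp_Hausdorff_space by blast
    then obtain W W' where W: "openin X W" "x \<in> W" "y \<in> W'" "disjnt W W'"
      using xy unfolding Hausdorff_space_def space_M by metis
    obtain V where "V \<in> B" "x \<in> V" "V \<subseteq> W" using B(3)[OF W(1,2)] by blast
    moreover have "y \<notin> V" using W(3,4) \<open>V \<subseteq> W\<close> unfolding disjnt_def by blast
    moreover have "V \<in> range U" using \<open>V \<in> B\<close> unfolding range_U by simp
    ultimately show ?thesis by blast
  qed
  ultimately show thesis by (rule that)
qed

text \<open>The set \<open>{x}\<close> moves with \<open>x\<close>, so \<open>meas\<close> does not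
  apply to it directly. For fixed \<open>n\<close> the cell \<open>P n x\<close> takes only finitely
  many values, each on a measurable set of points, so measurability there is piecewise; the limit
  then follows from \<open>signed_measure_decseq\<close>.\<close>

lemma measurable_signed_kernel_singleton:
  assumes M: "standard_borel M"
    and signed: "\<And>x t. x \<in> space M \<Longrightarrow> t \<in> space L \<Longrightarrow> signed_measure M (q x t)"
    and meas: "\<And>B. B \<in> sets M \<Longrightarrow> (\<lambda>(x, t). q x t B) \<in> borel_measurable (M \<Otimes>\<^sub>M L)"
  shows "(\<lambda>(x, t). q x t {x}) \<in> borel_measurable (M \<Otimes>\<^sub>M L)"
proof -
  obtain U :: "nat \<Rightarrow> 'a set" where U: "range U \<subseteq> sets M"
    and sep: "\<And>x y. x \<in> space M \<Longrightarrow> y \<in> space M \<Longrightarrow> x \<noteq> y \<Longrightarrow> \<exists>k. x \<in> U k \<and> y \<notin> U k"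
    using standard_borel_separating_sequence[OF M] by metis
  have U_sets: "U k \<in> sets M" for k using U by blast
  \<comment> \<open>The cell of \<open>x\<close> in the partition generated by the first
    \<open>n\<close> sets. The factor \<open>space M\<close> keeps it measurable, as
    \<open>- U k\<close> is a complement in the whole type.\<close>
  define P where "P n x = space M \<inter> (\<Inter>k<n. if x \<in> U k then U k else - U k)" for n x
  have P_Suc: "P (Suc n) x = (if x \<in> U n then U n \<inter> P n x else P n x - U n)" for n x
    unfolding P_def lessThan_Suc by auto
  have P_sets: "P n x \<in> sets M" for n x
  proof (induction n)
    case 0
    show ?case unfolding P_def by simp
  next
    case (Suc n)
    then show ?case unfolding P_Suc using U_sets by auto
  qed
  \<comment> \<open>Generality in \<open>B\<close> lets the induction absorb the newest set:
    according to whether \<open>x\<close> lies in \<open>U n\<close>, \<open>B\<close> is replaced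
    by its part inside or outside \<open>U n\<close>, and the cell drops back to level
    \<open>n\<close>.\<close>
  have meas_P: "(\<lambda>(x, t). q x t (B \<inter> P n x)) \<in> borel_measurable (M \<Otimes>\<^sub>M L)" if "B \<in> sets M" for B n
    using that
  proof (induction n arbitrary: B)
    case 0
    then have "B \<inter> P 0 x = B" for x unfolding P_def using sets.sets_into_space by auto
    then show ?case using meas[OF 0] by simp
  next
    case (Suc n)
    have split: "(\<lambda>(x, t). q x t (B \<inter> P (Suc n) x)) =
        (\<lambda>w. if fst w \<in> U n then (case w of (x, t) \<Rightarrow> q x t ((B \<inter> U n) \<inter> P n x))
             else (case w of (x, t) \<Rightarrow> q x t ((B - U n) \<inter> P n x)))"
    proof -
      have "B \<inter> P (Suc n) x = (if x \<in> U n then (B \<inter> U n) \<inter> P n x else (B - U n) \<inter> P n x)" for x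
        unfolding P_Suc by auto
      then show ?thesis by (simp add: fun_eq_iff)
    qed
    have "{w \<in> space (M \<Otimes>\<^sub>M L). fst w \<in> U n} \<in> sets (M \<Otimes>\<^sub>M L)"
      using measurable_sets[OF measurable_fst U_sets[of n], of L]
      by (simp add: vimage_def Int_def conj_commute)
    then show ?case
      unfolding split using Suc.prems U_sets by (intro measurable_If Suc.IH) auto
  qed
  have decseq: "decseq (\<lambda>n. P n x)" for x
    by (rule decseq_SucI) (auto simp: P_Suc)
  \<comment> \<open>If \<open>y\<close> differs from \<open>x\<close>, some \<open>U k\<close>
    contains \<open>x\<close> but not \<open>y\<close>, which expels \<open>y\<close> from the cell
    at level \<open>Suc k\<close>, the first to take \<open>U k\<close> into account.\<close>
  have Inter_P: "(\<Inter>n. P n x) = {x}" if x: "x \<in> space M" for x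
  proof (intro equalityI subsetI)
    fix y assume y: "y \<in> (\<Inter>n. P n x)"
    have "y \<in> space M" using y unfolding P_def by blast
    moreover have "y \<in> U k" if "x \<in> U k" for k
      using y that P_Suc[of k x] by (auto dest: spec[of _ "Suc k"])
    ultimately show "y \<in> {x}" using sep[OF x] by blast
  qed (use x in \<open>auto simp: P_def\<close>)
  have lim: "(\<lambda>n. q x t (P n x)) \<longlonglongrightarrow> q x t {x}" if "x \<in> space M" "t \<in> space L" for x t
  proof -
    have "range (\<lambda>n. P n x) \<subseteq> sets M" using P_sets by blast
    from signed_measure_decseq[OF signed[OF that] this decseq] show ?thesis
      using Inter_P[OF that(1)] by simp
  qed
  show ?thesis
  proof (rule borel_measurable_LIMSEQ_real)
    show "(\<lambda>(x, t). q x t (P n x)) \<in> borel_measurable (M \<Otimes>\<^sub>M L)" for n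
    proof -
      have "space M \<inter> P n x = P n x" for x unfolding P_def by blast
      then show ?thesis using meas_P[OF sets.top, of n] by simp
    qed
    show "(\<lambda>n. case w of (x, t) \<Rightarrow> q x t (P n x)) \<longlonglongrightarrow> (case w of (x, t) \<Rightarrow> q x t {x})"
      if "w \<in> space (M \<Otimes>\<^sub>M L)" for w
      using that lim by (auto simp: space_pair_measure)
  qed
qed

section \<open>Conditions on the jump rates\<close>

lemma sup_rate_le_iff:
  "sup_rate T0 T1 q x \<le> ennreal c \<longleftrightarrow>
    (\<forall>t\<in>time_interval T0 T1. ennreal (exit_rate q x t) \<le> ennreal c)"
  unfolding sup_rate_def by (rule SUP_le_iff)

lemma A1_imp_A2:
  assumes "A1 M T0 T1 q"
  shows "A2 M T0 T1 q"
  unfolding A2_def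
proof
  fix x assume x: "x \<in> space M"
  obtain B :: "nat \<Rightarrow> 'a set" where B: "\<And>n. n \<ge> 1 \<Longrightarrow> (SUP x\<in>B n. sup_rate T0 T1 q x) < of_nat n"
      "(\<Union>n\<in>{1..}. B n) = space M"
    using assms unfolding A1_def by blast
  then obtain n where n: "n \<ge> 1" "x \<in> B n" using x by auto
  have "sup_rate T0 T1 q x \<le> (SUP x\<in>B n. sup_rate T0 T1 q x)" using n(2) by (rule SUP_upper)
  also have "\<dots> < of_nat n" using B(1)[OF n(1)] .
  also have "\<dots> \<le> \<infinity>" by simp
  finally show "sup_rate T0 T1 q x < \<infinity>" .
qed

lemma A2_imp_A3:
  assumes "A2 M T0 T1 q"
  shows "A3 M T0 T1 q"
  unfolding A3_def
proof (intro allI impI ballI)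
  fix s x assume s: "ereal s < T1" and x: "x \<in> space M"
  have "{T0..<s} \<subseteq> time_interval T0 T1"
    using s unfolding time_interval_def by (auto intro: less_trans[of _ "ereal s"])
  then have "(SUP t\<in>{T0..<s}. ennreal (exit_rate q x t)) \<le> sup_rate T0 T1 q x"
    unfolding sup_rate_def by (rule SUP_subset_mono) simp
  also have "\<dots> < \<infinity>" using assms x unfolding A2_def by blast
  finally show "(SUP t\<in>{T0..<s}. ennreal (exit_rate q x t)) < \<infinity>" .
qed

lemma A3_imp_A4:
  assumes "A3 M T0 T1 q"
  shows "A4 M T0 T1 q"
  unfolding A4_def
proof (intro allI impI ballI)
  fix s x assume s: "T0 < s" "ereal s < T1" and x: "x \<in> space M"
  \<comment> \<open>(A3) bounds the rate only for times before \<open>s\<close>, while the integral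
    runs over the closed interval. The rate at \<open>s\<close> is a single real number, so
    including it keeps the bound finite.\<close>
  define K where "K = max (SUP t\<in>{T0..<s}. ennreal (exit_rate q x t)) (ennreal (exit_rate q x s))"
  have "(SUP t\<in>{T0..<s}. ennreal (exit_rate q x t)) < \<infinity>"
    using assms s x unfolding A3_def by blast
  then have "K < \<infinity>" unfolding K_def by simp
  have "ennreal (exit_rate q x t) \<le> K" if "t \<in> {T0..s}" for t
  proof (cases "t = s")
    case False
    then have "ennreal (exit_rate q x t) \<le> (SUP t\<in>{T0..<s}. ennreal (exit_rate q x t))"
      using that by (intro SUP_upper) simp
    then show ?thesis unfolding K_def by (rule max.coboundedI1)
  qed (simp add: K_def)
  then have "(\<integral>\<^sup>+t\<in>{T0..s}. ennreal (exit_rate q x t) \<partial>lborel) \<le> (\<integral>\<^sup>+t. K * indicator {T0..s} t \<partial>lborel)"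
    by (intro nn_integral_mono) (simp split: split_indicator)
  also have "\<dots> = K * ennreal (s - T0)" using s(1) by (simp add: nn_integral_cmult_indicator)
  also have "\<dots> < \<infinity>" using \<open>K < \<infinity>\<close> by (simp add: ennreal_mult_less_top)
  finally show "(\<integral>\<^sup>+t\<in>{T0..s}. ennreal (exit_rate q x t) \<partial>lborel) < \<infinity>" .
qed

lemma A2_imp_A1:
  assumes M: "standard_borel M" and "ereal T0 < T1" and q: "Q_function M T0 T1 q"
    and A2: "A2 M T0 T1 q"
  shows "A1 M T0 T1 q"
proof -
  define T where "T = time_interval T0 T1"
  define L where "L = restrict_space (borel :: real measure) T"
  have space_L: "space L = T" unfolding L_def by (simp add: space_restrict_space)
  have "T0 \<in> T" using \<open>ereal T0 < T1\<close> unfolding T_def time_interval_def by simp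
  have "T = {T0..} \<inter> ereal -` {..<T1}" unfolding T_def time_interval_def by auto
  then have T_borel: "T \<in> sets borel"
    by (auto intro!: borel_open open_vimage continuous_on_ereal continuous_on_id)
  have "(\<lambda>(x, t). q x t {x}) \<in> borel_measurable (M \<Otimes>\<^sub>M L)"
  proof (rule measurable_signed_kernel_singleton[OF M])
    show "signed_measure M (q x t)" if "x \<in> space M" "t \<in> space L" for x t
      using q that unfolding Q_function_def space_L T_def by blast
    show "(\<lambda>(x, t). q x t B) \<in> borel_measurable (M \<Otimes>\<^sub>M L)" if "B \<in> sets M" for B
      using q that unfolding Q_function_def L_def T_def by blast
  qed
  then have rate: "(\<lambda>w. exit_rate q (fst w) (snd w)) \<in> borel_measurable (M \<Otimes>\<^sub>M L)"
    unfolding exit_rate_def by (simp add: case_prod_beta')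
  (* Replacing times outside T by T0 does not change the projections to the state space and allows
     working with the Polish space of all reals instead of T. *)
  define \<tau> where "\<tau> t = (if t \<in> T then t else T0)" for t
  have \<tau>_T: "\<tau> t \<in> T" for t using \<open>T0 \<in> T\<close> unfolding \<tau>_def by simp
  have "\<tau> \<in> borel_measurable borel"
    unfolding \<tau>_def using T_borel by (intro measurable_If_set) auto
  then have "\<tau> \<in> measurable borel L"
    unfolding L_def using \<tau>_T by (intro measurable_restrict_space2) auto
  then have "(\<lambda>w. (fst w, \<tau> (snd w))) \<in> measurable (M \<Otimes>\<^sub>M borel) (M \<Otimes>\<^sub>M L)"
    by (intro measurable_Pair measurable_fst measurable_compose[OF measurable_snd])
  from measurable_compose[OF this rate] have rate': "(\<lambda>w. exit_rate q (fst w) (\<tau> (snd w))) \<in> borel_measurable (M \<Otimes>\<^sub>M borel)"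
    by simp
  \<comment> \<open>A supremum exceeds \<open>n\<close> exactly if some rate does, so the projection
    of \<open>E n\<close> is the superlevel set of \<open>sup_rate\<close> at
    \<open>n\<close>.\<close>
  define E where "E n = {w \<in> space (M \<Otimes>\<^sub>M borel). real n < exit_rate q (fst w) (\<tau> (snd w))}" for n
  have E: "E n \<in> sets (M \<Otimes>\<^sub>M borel)" for n
    unfolding E_def using rate' by measurable
  have fst_E: "x \<in> fst ` E n \<longleftrightarrow> x \<in> space M \<and> (\<exists>t\<in>T. real n < exit_rate q x t)" for x n
  proof
    assume "x \<in> fst ` E n"
    then show "x \<in> space M \<and> (\<exists>t\<in>T. real n < exit_rate q x t)"
      using \<tau>_T unfolding E_def by (auto simp: space_pair_measure)
  next
    assume "x \<in> space M \<and> (\<exists>t\<in>T. real n < exit_rate q x t)"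
    then obtain t where "x \<in> space M" "t \<in> T" "real n < exit_rate q x t" by blast
    then have "(x, t) \<in> E n" unfolding E_def \<tau>_def by (simp add: space_pair_measure)
    then show "x \<in> fst ` E n" by force
  qed
  have "(\<Inter>n. fst ` E n) = {}"
  proof (rule equals0I)
    fix x assume x: "x \<in> (\<Inter>n. fst ` E n)"
    then have "x \<in> fst ` E 0" by (rule INT_D) simp
    then have "x \<in> space M" unfolding fst_E by simp
    then have "sup_rate T0 T1 q x < \<infinity>" using A2 unfolding A2_def by blast
    then obtain n :: nat where n: "sup_rate T0 T1 q x < of_nat n"
      using ennreal_Ex_less_of_nat[of "sup_rate T0 T1 q x"] by (auto simp: less_top)
    have "x \<in> fst ` E n" using x by (rule INT_D) simp
    then obtain t where t: "t \<in> T" "real n < exit_rate q x t" unfolding fst_E by blast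
    have "of_nat n \<le> ennreal (exit_rate q x t)"
      unfolding ennreal_of_nat_eq_real_of_nat using t(2) by (intro ennreal_leI) simp
    also have "\<dots> \<le> sup_rate T0 T1 q x"
      unfolding sup_rate_def using t(1) unfolding T_def by (rule SUP_upper)
    finally show False using n by simp
  qed
  then have "Borel_separable M (\<lambda>n. fst ` E n)"
    by (rule Borel_separable_projections[OF M E])
  then obtain C where C': "\<forall>n. C n \<in> sets M \<and> fst ` E n \<subseteq> C n" and C_empty: "(\<Inter>n. C n) = {}"
    unfolding Borel_separable_def by (elim exE conjE)
  have C: "C n \<in> sets M" "fst ` E n \<subseteq> C n" for n using C' by simp_all
  \<comment> \<open>Points of \<open>B n\<close> avoid some \<open>C k\<close> with k < n, so their
    rates are at most that \<open>k\<close>. Measurability is argued for n at least 1, because the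
    empty intersection at n = 0 is \<open>UNIV\<close>.\<close>
  define B where "B n = space M - (\<Inter>k<n. C k)" for n
  have "B n \<in> sets M" if "n \<ge> 1" for n
  proof -
    have "(\<Inter>k<n. C k) \<in> sets M" using that by (intro sets.finite_INT C(1)) (auto simp: lessThan_empty_iff)
    then show ?thesis unfolding B_def by (intro sets.Diff sets.top)
  qed
  moreover have "(SUP x\<in>B n. sup_rate T0 T1 q x) < of_nat n" if n: "n \<ge> 1" for n
  proof -
    \<comment> \<open>A strict pointwise bound could be lost in the supremum over
      \<open>B n\<close>; the weak bound n - 1 survives it and is still strictly below
      \<open>n\<close>.\<close>
    have "sup_rate T0 T1 q x \<le> of_nat (n - 1)" if x: "x \<in> B n" for x
    proof -
      obtain k where k: "x \<in> space M" "k < n" "x \<notin> C k" using x unfolding B_def by blast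
      then have "x \<notin> fst ` E k" using C(2) by blast
      then have le: "exit_rate q x t \<le> real k" if "t \<in> T" for t
        using k(1) that unfolding fst_E by (meson not_le)
      have "sup_rate T0 T1 q x \<le> ennreal (real k)"
        unfolding sup_rate_le_iff using le unfolding T_def by (intro ballI ennreal_leI)
      also have "\<dots> \<le> ennreal (real (n - 1))" using k(2) by (intro ennreal_leI) simp
      finally show ?thesis by (simp add: ennreal_of_nat_eq_real_of_nat)
    qed
    then have "(SUP x\<in>B n. sup_rate T0 T1 q x) \<le> of_nat (n - 1)" by (rule SUP_least)
    also have "(of_nat (n - 1) :: ennreal) < of_nat n" using n by simp
    finally show ?thesis .
  qed
  moreover have "B n \<subseteq> B (Suc n)" for n unfolding B_def by auto
  moreover have "(\<Union>n\<in>{1..}. B n) = space M"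
  proof (intro equalityI subsetI)
    fix x assume x: "x \<in> space M"
    obtain k where "x \<notin> C k" using C_empty by blast
    then have "x \<in> B (Suc k)" using x unfolding B_def by blast
    then show "x \<in> (\<Union>n\<in>{1..}. B n)" by (intro UN_I[of "Suc k"]) simp_all
  qed (simp add: B_def)
  ultimately show ?thesis unfolding A1_def by (intro exI[of _ B] conjI allI impI)
qed

theorem lemma1:
  fixes M :: "'a measure" and T0 :: real and T1 :: ereal
    and q :: "'a \<Rightarrow> real \<Rightarrow> 'a set \<Rightarrow> real"
  assumes "standard_borel M"
    and "0 \<le> T0" and "ereal T0 < T1"
    and "Q_function M T0 T1 q"
    and "conservative M T0 T1 q"
  shows "(A1 M T0 T1 q \<longleftrightarrow> A2 M T0 T1 q) \<and>
         (A2 M T0 T1 q \<longrightarrow> A3 M T0 T1 q) \<and>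
         (A3 M T0 T1 q \<longrightarrow> A4 M T0 T1 q)"
  using A1_imp_A2 A2_imp_A1[OF assms(1,3,4)] A2_imp_A3 A3_imp_A4 by blast

end
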